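(* Let $f:\mathcal H\to\mathbb R$ be twice continuously differentiable and $\mu$-strongly convex with $\mu>0$, let $x^*$ be its unique minimizer, let $\Delta_1,\Delta_2\ge 0$ be constants, and let $X:[0,\infty)\to\mathcal H$, $t\mapsto X_t$, be a solution of $$\ddot{X_t}+2\sqrt{\mu}\,\dot{X_t}+(1+\Delta_1)\nabla f(X_t)+\Delta_2\nabla^2 f(X_t)\dot{X_t}=0 .$$ Define $$\mathcal{E}(t)= e^{\sqrt{\mu}t}\Big((1+\Delta_1)(f(X_t)-f(x^* ))+\tfrac{1}{2}\|\dot{X_t}+\sqrt{\mu}(X_t-x^* )+\Delta_2\nabla f(X_t)\|^2\Big).$$ Then for all $t\ge 0$, $$\frac{\mathrm d\mathcal{E}(t)}{\mathrm dt}e^{-\sqrt{\mu}t}\le -\frac{\sqrt{\mu}}{2}\|\dot{X_t}\|^2-\frac{\mu\sqrt{\mu}}{2}\Delta_1\|X_t-x^*\|^2+\Delta_2\Big(\frac{\sqrt{\mu}}{2}\Delta_2-\Delta_1\Big)\|\nabla f(X_t)\|^2 .$$ If $0\le \frac{\sqrt{\mu}}{2}\Delta_2\le \Delta_1$, then for all $t\ge 0$, $$f(X_t)-f(x^* )\le \frac{1}{1+\Delta_1}e^{-\sqrt{\mu}t}\mathcal{E}(0).$$ Besides, if $\Delta_1=0$, $\Delta_2>0$ and $f$ is $L$-smooth, then for all $t\ge 0$, $$f(X_t)-f(x^* )\le \frac{1}{1+\Delta_1}e^{-\sqrt{\mu}t(1-\Delta_2^2L)}\mathcal{E}(0).$$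
   Context: $\mathcal H$ is a real finite-dimensional Hilbert space with inner product $\langle\cdot,\cdot\rangle$ and induced norm $\|\cdot\|$. A continuously differentiable $f$ is $\mu$-strongly convex if $f(y)-f(x)\ge\langle\nabla f(x),y-x\rangle+\frac{\mu}{2}\|y-x\|^2$ for all $x,y\in\mathcal H$, and $L$-smooth if $\|\nabla f(x)-\nabla f(y)\|\le L\|x-y\|$ for all $x,y\in\mathcal H$. $\dot{X_t}$ and $\ddot{X_t}$ denote the first and second derivatives of $t\mapsto X_t$; $\nabla^2 f$ is the Hessian. *)

theory Defs
  imports "HOL-Analysis.Analysis"
begin

lemma gderiv_unique:
  assumes "GDERIV f x :> g" "GDERIV f x :> h"
  shows "g = h"
proof -
  have "(\<lambda>v. inner v g) = (\<lambda>v. inner v h)"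
    using assms unfolding gderiv_def by (rule has_derivative_unique)
  then have "inner (g - h) g = inner (g - h) h"
    by (rule fun_cong)
  then have "inner (g - h) (g - h) = 0"
    unfolding inner_diff_right[of "g - h" g h] by simp
  then show ?thesis
    by simp
qed

definition gradient :: "('a::real_inner \<Rightarrow> real) \<Rightarrow> 'a \<Rightarrow> 'a"
  where "gradient f x = (THE g. GDERIV f x :> g)"

lemma gradient_eq: "GDERIV f x :> g \<Longrightarrow> gradient f x = g"
  unfolding gradient_def by (blast intro: gderiv_unique)

text \<open>The Hessian is the linear operator given by the Frechet derivative of the gradient.\<close>

definition hessian :: "('a::real_inner \<Rightarrow> real) \<Rightarrow> 'a \<Rightarrow> 'a \<Rightarrow>\<^sub>L 'a"
  where "hessian f x = Blinfun (frechet_derivative (gradient f) (at x))"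

text \<open>On a Hilbert space, differentiability of \<open>f\<close> is existence of the gradient, by Riesz
  representation.  Continuity of the Hessian is with respect to the operator norm.\<close>

definition twice_continuously_differentiable :: "('a::real_inner \<Rightarrow> real) \<Rightarrow> bool"
  where "twice_continuously_differentiable f \<longleftrightarrow>
    (\<forall>x. \<exists>g. GDERIV f x :> g) \<and>
    (\<forall>x. gradient f differentiable (at x)) \<and>
    continuous_on UNIV (hessian f)"

text \<open>Strong convexity and smoothness are meant for continuously differentiable \<open>f\<close>; otherwise
  \<open>gradient f\<close> need not have a meaning.\<close>

definition strongly_convex :: "real \<Rightarrow> ('a::real_inner \<Rightarrow> real) \<Rightarrow> bool"
  where "strongly_convex \<mu> f \<longleftrightarrow>
    (\<forall>x y. f y - f x \<ge> inner (gradient f x) (y - x) + \<mu> / 2 * (norm (y - x))\<^sup>2)"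

definition smooth_gradient :: "real \<Rightarrow> ('a::real_inner \<Rightarrow> real) \<Rightarrow> bool"
  where "smooth_gradient L f \<longleftrightarrow>
    (\<forall>x y. norm (gradient f x - gradient f y) \<le> L * norm (x - y))"

text \<open>A curve on \<open>[0, \<infinity>)\<close> is represented by a function on all reals whose values at negative
  times are irrelevant.  Derivatives are taken within \<open>[0, \<infinity>)\<close>: they are one-sided at \<open>0\<close>
  and two-sided at positive times.\<close>

definition velocity :: "(real \<Rightarrow> 'a::real_normed_vector) \<Rightarrow> real \<Rightarrow> 'a"
  where "velocity X t = vector_derivative X (at t within {0..})"

definition acceleration :: "(real \<Rightarrow> 'a::real_normed_vector) \<Rightarrow> real \<Rightarrow> 'a"
  where "acceleration X t = vector_derivative (velocity X) (at t within {0..})"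

definition ode_solution ::
  "real \<Rightarrow> real \<Rightarrow> real \<Rightarrow> ('a::real_inner \<Rightarrow> real) \<Rightarrow> (real \<Rightarrow> 'a) \<Rightarrow> bool"
  where "ode_solution \<mu> \<Delta>1 \<Delta>2 f X \<longleftrightarrow>
    (\<forall>t\<ge>0. X differentiable (at t within {0..}) \<and>
      velocity X differentiable (at t within {0..}) \<and>
      acceleration X t + (2 * sqrt \<mu>) *\<^sub>R velocity X t + (1 + \<Delta>1) *\<^sub>R gradient f (X t)
        + \<Delta>2 *\<^sub>R blinfun_apply (hessian f (X t)) (velocity X t) = 0)"

definition energy ::
  "real \<Rightarrow> real \<Rightarrow> real \<Rightarrow> ('a::real_inner \<Rightarrow> real) \<Rightarrow> 'a \<Rightarrow> (real \<Rightarrow> 'a) \<Rightarrow> real \<Rightarrow> real"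
  where "energy \<mu> \<Delta>1 \<Delta>2 f xstar X t =
    exp (sqrt \<mu> * t) *
      ((1 + \<Delta>1) * (f (X t) - f xstar)
        + 1 / 2 * (norm (velocity X t + sqrt \<mu> *\<^sub>R (X t - xstar) + \<Delta>2 *\<^sub>R gradient f (X t)))\<^sup>2)"

end

theory Submission
  imports Defs
begin

text \<open>
  Put \<open>s = sqrt \<mu>\<close>, \<open>a = 1 + \<Delta>1\<close>, \<open>z = X - xstar\<close>, \<open>g = gradient f X\<close>, \<open>v = velocity X\<close> and
  \<open>V = v + s z + \<Delta>2 g\<close>.  The vector \<open>V\<close> is chosen so that its derivative is free of the Hessian:
  differentiating \<open>\<Delta>2 g\<close> produces exactly the Hessian damping term of the equation, and the two
  cancel, leaving \<open>V' = - s v - a g\<close>.  Hence the derivative of the energy is an explicit quadratic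
  expression in \<open>z\<close>, \<open>g\<close>, \<open>v\<close> and the gap \<open>f X - f xstar\<close>, in which all terms \<open>\<langle>v, z\<rangle>\<close> and
  \<open>\<langle>v, g\<rangle>\<close> cancel.  What remains is controlled by strong convexity: its inequality
  from \<open>X\<close> to \<open>xstar\<close> absorbs the gap, and \<open>\<mu> \<langle>z, g\<rangle> \<le> \<langle>g, g\<rangle>\<close> absorbs the remaining mixed term
  (\<open>energy_dissipation\<close>).

  Both rates are then instances of the Gronwall inequality \<open>gronwall_half_line\<close> for
  \<open>E' \<le> c E\<close>.  If \<open>s \<Delta>2 / 2 \<le> \<Delta>1\<close> then every term of the bound is nonpositive and \<open>c = 0\<close>.
  If \<open>\<Delta>1 = 0\<close> the only positive term is \<open>s \<Delta>2\<^sup>2 / 2 * (norm g)\<^sup>2\<close>; for \<open>L\<close>-smooth \<open>f\<close> it is at most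
  \<open>s \<Delta>2\<^sup>2 L\<close> times the gap, since \<open>(norm g)\<^sup>2 \<le> 2 L (f X - f xstar)\<close>, so \<open>c = s \<Delta>2\<^sup>2 L\<close>.
\<close>

section \<open>Gradients\<close>

lemma gderiv_gradient:
  assumes "twice_continuously_differentiable f"
  shows "GDERIV f x :> gradient f x"
  using assms gradient_eq unfolding twice_continuously_differentiable_def by metis

lemma gradient_has_derivative_hessian:
  assumes "twice_continuously_differentiable f"
  shows "(gradient f has_derivative blinfun_apply (hessian f x)) (at x)"
proof -
  have der: "(gradient f has_derivative frechet_derivative (gradient f) (at x)) (at x)"
    using assms frechet_derivative_works
    unfolding twice_continuously_differentiable_def by blast
  then have "bounded_linear (frechet_derivative (gradient f) (at x))"
    by (rule has_derivative_bounded_linear)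
  then show ?thesis
    using der by (simp add: hessian_def bounded_linear_Blinfun_apply)
qed

lemma gradient_eq_0_at_minimizer:
  assumes "GDERIV f x :> gradient f x" and "\<And>y. f x \<le> f y"
  shows "gradient f x = 0"
proof -
  have "(\<lambda>h. inner h (gradient f x)) = (\<lambda>h. 0)"
    using assms(1) unfolding gderiv_def
    by (rule has_derivative_local_min) (simp add: assms(2))
  then have "inner (gradient f x) (gradient f x) = 0"
    by (rule fun_cong)
  then show ?thesis by simp
qed

lemma has_real_derivative_along_line:
  assumes "GDERIV f (x + t *\<^sub>R h) :> g"
  shows "((\<lambda>t. f (x + t *\<^sub>R h)) has_real_derivative inner g h) (at t)"
proof -
  have "((\<lambda>t. x + t *\<^sub>R h) has_derivative (\<lambda>u. u *\<^sub>R h)) (at t)"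
    by (auto intro!: derivative_eq_intros)
  from has_derivative_compose[OF this assms[unfolded gderiv_def]]
  show ?thesis
    by (simp add: has_field_derivative_def inner_commute mult_commute_abs)
qed

text \<open>The descent lemma: along the segment from \<open>x\<close> to \<open>x + h\<close>, the function minus its
  quadratic model is nonincreasing, because Lipschitz continuity of the gradient bounds its
  derivative.\<close>

lemma smooth_gradient_descent:
  assumes diff: "\<And>x. GDERIV f x :> gradient f x" and smooth: "smooth_gradient L f"
  shows "f (x + h) \<le> f x + inner (gradient f x) h + L / 2 * (norm h)\<^sup>2"
proof -
  define \<phi> where "\<phi> t = f (x + t *\<^sub>R h) - t * inner (gradient f x) h - L / 2 * t\<^sup>2 * (norm h)\<^sup>2"
    for t
  define \<phi>' where "\<phi>' t = inner (gradient f (x + t *\<^sub>R h) - gradient f x) h - L * t * (norm h)\<^sup>2"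
    for t
  have der: "(\<phi> has_real_derivative \<phi>' t) (at t)" for t
    unfolding \<phi>_def \<phi>'_def
    by (auto intro!: derivative_eq_intros has_real_derivative_along_line diff
        simp: inner_diff_left)
  have nonpos: "\<phi>' t \<le> 0" if "t \<ge> 0" for t
  proof -
    have "inner (gradient f (x + t *\<^sub>R h) - gradient f x) h
        \<le> norm (gradient f (x + t *\<^sub>R h) - gradient f x) * norm h"
      by (rule norm_cauchy_schwarz)
    also have "\<dots> \<le> (L * norm ((x + t *\<^sub>R h) - x)) * norm h"
      using smooth unfolding smooth_gradient_def by (intro mult_right_mono norm_ge_zero) blast
    also have "\<dots> = L * t * (norm h)\<^sup>2"
      using that by (simp add: power2_eq_square)
    finally show ?thesis by (simp add: \<phi>'_def)
  qed
  have "\<phi> 1 \<le> \<phi> 0"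
  proof (rule DERIV_nonpos_imp_nonincreasing[where f = \<phi>])
    show "\<exists>y. (\<phi> has_real_derivative y) (at t) \<and> y \<le> 0" if "0 \<le> t" for t
      using der nonpos that by blast
  qed simp
  then show ?thesis by (simp add: \<phi>_def)
qed

section \<open>Strongly convex functions near their minimizer\<close>

context
  fixes f :: "'a::real_inner \<Rightarrow> real" and \<mu> :: real and xstar :: 'a
  assumes diff: "\<And>x. GDERIV f x :> gradient f x"
    and mu_pos: "\<mu> > 0"
    and convex: "strongly_convex \<mu> f"
    and min: "\<And>x. f xstar \<le> f x"
begin

lemma gap_le_inner_gradient:
  "f x - f xstar \<le> inner (x - xstar) (gradient f x) - \<mu> / 2 * (norm (x - xstar))\<^sup>2"
proof -
  have "f xstar - f x \<ge> inner (gradient f x) (xstar - x) + \<mu> / 2 * (norm (xstar - x))\<^sup>2"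
    using convex unfolding strongly_convex_def by blast
  then show ?thesis
    by (simp add: inner_diff_right inner_diff_left inner_commute norm_minus_commute)
qed

lemma strong_monotonicity_at_minimizer:
  "\<mu> * (norm (x - xstar))\<^sup>2 \<le> inner (x - xstar) (gradient f x)"
proof -
  have "f x - f xstar \<ge> inner (gradient f xstar) (x - xstar) + \<mu> / 2 * (norm (x - xstar))\<^sup>2"
    using convex unfolding strongly_convex_def by blast
  moreover have "gradient f xstar = 0"
    using diff min by (rule gradient_eq_0_at_minimizer)
  ultimately have "f x - f xstar \<ge> \<mu> / 2 * (norm (x - xstar))\<^sup>2"
    by simp
  then show ?thesis
    using gap_le_inner_gradient[of x] by simp
qed

lemma norm_gradient_ge: "\<mu> * norm (x - xstar) \<le> norm (gradient f x)"
proof (cases "x = xstar")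
  case False
  have "\<mu> * norm (x - xstar) * norm (x - xstar) \<le> norm (gradient f x) * norm (x - xstar)"
    using strong_monotonicity_at_minimizer[of x] norm_cauchy_schwarz[of "x - xstar" "gradient f x"]
    by (simp add: power2_eq_square mult_ac)
  then show ?thesis
    using False by simp
qed simp

lemma inner_gradient_le: "\<mu> * inner (x - xstar) (gradient f x) \<le> (norm (gradient f x))\<^sup>2"
proof -
  have "\<mu> * inner (x - xstar) (gradient f x) \<le> \<mu> * (norm (x - xstar) * norm (gradient f x))"
    using mu_pos norm_cauchy_schwarz by (intro mult_left_mono) auto
  also have "\<dots> = (\<mu> * norm (x - xstar)) * norm (gradient f x)"
    by simp
  also have "\<dots> \<le> norm (gradient f x) * norm (gradient f x)"
    using norm_gradient_ge by (intro mult_right_mono) auto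
  finally show ?thesis by (simp add: power2_eq_square)
qed

text \<open>For \<open>L > 0\<close> a gradient step of length \<open>1 / L\<close> decreases \<open>f\<close> by at least
  \<open>(norm (gradient f x))\<^sup>2 / (2 L)\<close>, which cannot exceed the gap.  For \<open>L \<le> 0\<close> smoothness forces
  the gradient to vanish, so that \<open>x\<close> is the minimizer.\<close>

lemma norm_gradient_power2_le_gap:
  assumes smooth: "smooth_gradient L f"
  shows "(norm (gradient f x))\<^sup>2 \<le> 2 * L * (f x - f xstar)"
proof (cases "L > 0")
  case True
  have "f xstar \<le> f (x + (- (1 / L)) *\<^sub>R gradient f x)"
    by (rule min)
  also have "\<dots> \<le> f x + inner (gradient f x) ((- (1 / L)) *\<^sub>R gradient f x)
      + L / 2 * (norm ((- (1 / L)) *\<^sub>R gradient f x))\<^sup>2"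
    using diff smooth by (rule smooth_gradient_descent)
  also have "\<dots> = f x - (norm (gradient f x))\<^sup>2 / (2 * L)"
    unfolding inner_scaleR_right power2_norm_eq_inner[symmetric] norm_scaleR power_mult_distrib
    using True by (simp add: field_simps power2_eq_square)
  finally show ?thesis
    using True by (simp add: field_simps)
next
  case False
  have "gradient f xstar = 0"
    using diff min by (rule gradient_eq_0_at_minimizer)
  then have "norm (gradient f x) \<le> L * norm (x - xstar)"
    using smooth unfolding smooth_gradient_def by (metis diff_zero)
  also have "\<dots> \<le> 0"
    using False by (simp add: mult_nonpos_nonneg)
  finally have grad: "gradient f x = 0" by simp
  then have "x = xstar"
    using norm_gradient_ge[of x] mu_pos by (simp add: mult_le_0_iff)
  then show ?thesis
    using grad by simp
qed

end

section \<open>Differential inequalities\<close>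

text \<open>Multiplying by \<open>exp (- (c * t))\<close> turns the differential inequality into monotonicity.  The
  one-sided derivative at \<open>0\<close> provides continuity up to the endpoint.\<close>

lemma gronwall_half_line:
  fixes E E' :: "real \<Rightarrow> real"
  assumes der: "\<And>t. t \<ge> 0 \<Longrightarrow> (E has_real_derivative E' t) (at t within {0..})"
    and le: "\<And>t. t \<ge> 0 \<Longrightarrow> E' t \<le> c * E t"
    and "t \<ge> 0"
  shows "E t \<le> exp (c * t) * E 0"
proof -
  define F where "F u = exp (- (c * u)) * E u" for u
  have F: "(F has_real_derivative exp (- (c * u)) * (E' u - c * E u)) (at u within {0..})"
    if "u \<ge> 0" for u
    unfolding F_def
    by (auto intro!: derivative_eq_intros der that simp: algebra_simps)
  have "F t \<le> F 0"
  proof (rule DERIV_nonpos_imp_decreasing_open[OF \<open>t \<ge> 0\<close>])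
    fix u :: real
    assume u: "0 < u" "u < t"
    then have "at u within {0..} = at u"
      by (intro at_within_interior) simp
    then have "(F has_real_derivative exp (- (c * u)) * (E' u - c * E u)) (at u)"
      using F[of u] u by simp
    moreover have "exp (- (c * u)) * (E' u - c * E u) \<le> 0"
      using le[of u] u by (intro mult_nonneg_nonpos) auto
    ultimately show "\<exists>y. (F has_real_derivative y) (at u) \<and> y \<le> 0"
      by blast
  next
    have "continuous_on {0..} F"
      using F by (intro DERIV_continuous_on) auto
    then show "continuous_on {0..t} F"
      by (rule continuous_on_subset) auto
  qed
  then have "exp (c * t) * F t \<le> exp (c * t) * F 0"
    by (intro mult_left_mono) auto
  then show ?thesis
    by (simp add: F_def mult.assoc[symmetric] exp_add[symmetric])
qed

section \<open>The energy along a solution\<close>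

text \<open>By the chain rule the last summand contributes \<open>\<Delta>2\<close> times the Hessian applied to the
  velocity; substituting the equation for the acceleration cancels it.\<close>

lemma momentum_has_vector_derivative:
  assumes C2: "twice_continuously_differentiable f"
    and solution: "ode_solution \<mu> \<Delta>1 \<Delta>2 f X" and "t \<ge> 0"
  shows "((\<lambda>t. velocity X t + sqrt \<mu> *\<^sub>R (X t - xstar) + \<Delta>2 *\<^sub>R gradient f (X t))
    has_vector_derivative - (sqrt \<mu> *\<^sub>R velocity X t) - (1 + \<Delta>1) *\<^sub>R gradient f (X t))
      (at t within {0..})"
proof -
  have "X differentiable (at t within {0..})" and "velocity X differentiable (at t within {0..})"
    and ode: "acceleration X t + (2 * sqrt \<mu>) *\<^sub>R velocity X t + (1 + \<Delta>1) *\<^sub>R gradient f (X t)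
        + \<Delta>2 *\<^sub>R blinfun_apply (hessian f (X t)) (velocity X t) = 0"
    using solution \<open>t \<ge> 0\<close> unfolding ode_solution_def by blast+
  then have X: "(X has_vector_derivative velocity X t) (at t within {0..})"
    and v: "(velocity X has_vector_derivative acceleration X t) (at t within {0..})"
    unfolding velocity_def[of X t] acceleration_def by (simp_all only: vector_derivative_works)
  have g: "((\<lambda>t. gradient f (X t)) has_vector_derivative
      blinfun_apply (hessian f (X t)) (velocity X t)) (at t within {0..})"
    using has_derivative_compose[OF X[unfolded has_vector_derivative_def]
        gradient_has_derivative_hessian[OF C2]]
    by (simp add: has_vector_derivative_def blinfun.scaleR_right)
  have "((\<lambda>t. velocity X t + sqrt \<mu> *\<^sub>R (X t - xstar) + \<Delta>2 *\<^sub>R gradient f (X t))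
    has_vector_derivative acceleration X t + sqrt \<mu> *\<^sub>R velocity X t
      + \<Delta>2 *\<^sub>R blinfun_apply (hessian f (X t)) (velocity X t)) (at t within {0..})"
    by (auto intro!: derivative_eq_intros X v g)
  also have "acceleration X t + sqrt \<mu> *\<^sub>R velocity X t
      + \<Delta>2 *\<^sub>R blinfun_apply (hessian f (X t)) (velocity X t)
    = - (sqrt \<mu> *\<^sub>R velocity X t) - (1 + \<Delta>1) *\<^sub>R gradient f (X t)"
  proof -
    have "(2 * sqrt \<mu>) *\<^sub>R velocity X t = sqrt \<mu> *\<^sub>R velocity X t + sqrt \<mu> *\<^sub>R velocity X t"
      by (simp add: scaleR_add_left[symmetric])
    then have "(acceleration X t + sqrt \<mu> *\<^sub>R velocity X t
          + \<Delta>2 *\<^sub>R blinfun_apply (hessian f (X t)) (velocity X t))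
        - (- (sqrt \<mu> *\<^sub>R velocity X t) - (1 + \<Delta>1) *\<^sub>R gradient f (X t)) = 0"
      unfolding ode[symmetric] by (simp add: algebra_simps)
    then show ?thesis by (simp only: right_minus_eq)
  qed
  finally show ?thesis .
qed

lemma energy_has_real_derivative:
  fixes xstar :: "'a::real_inner"
  assumes C2: "twice_continuously_differentiable f"
    and solution: "ode_solution \<mu> \<Delta>1 \<Delta>2 f X" and "t \<ge> 0"
  defines "V \<equiv> velocity X t + sqrt \<mu> *\<^sub>R (X t - xstar) + \<Delta>2 *\<^sub>R gradient f (X t)"
  shows "(energy \<mu> \<Delta>1 \<Delta>2 f xstar X has_real_derivative
    exp (sqrt \<mu> * t) *
      (sqrt \<mu> * ((1 + \<Delta>1) * (f (X t) - f xstar) + 1 / 2 * (norm V)\<^sup>2)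
        + (1 + \<Delta>1) * inner (gradient f (X t)) (velocity X t)
        + inner V (- (sqrt \<mu> *\<^sub>R velocity X t) - (1 + \<Delta>1) *\<^sub>R gradient f (X t))))
    (at t within {0..})"
proof -
  define W where "W u = velocity X u + sqrt \<mu> *\<^sub>R (X u - xstar) + \<Delta>2 *\<^sub>R gradient f (X u)" for u
  define W' where "W' = - (sqrt \<mu> *\<^sub>R velocity X t) - (1 + \<Delta>1) *\<^sub>R gradient f (X t)"
  have X: "(X has_vector_derivative velocity X t) (at t within {0..})"
    using solution \<open>t \<ge> 0\<close> unfolding ode_solution_def velocity_def[of X t]
    by (auto simp only: vector_derivative_works)
  have fX: "((\<lambda>t. f (X t)) has_real_derivative inner (gradient f (X t)) (velocity X t))
      (at t within {0..})"
    using has_derivative_compose[OF X[unfolded has_vector_derivative_def]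
        gderiv_gradient[OF C2, unfolded gderiv_def]]
    by (simp add: has_field_derivative_def inner_commute mult_commute_abs)
  have "(W has_vector_derivative W') (at t within {0..})"
    unfolding W_def[abs_def] W'_def
    using C2 solution \<open>t \<ge> 0\<close> by (rule momentum_has_vector_derivative)
  then have W: "(W has_derivative (\<lambda>h. h *\<^sub>R W')) (at t within {0..})"
    by (simp add: has_vector_derivative_def)
  have WW: "((\<lambda>u. inner (W u) (W u)) has_real_derivative 2 * inner (W t) W') (at t within {0..})"
    unfolding has_field_derivative_def
    by (rule has_derivative_eq_rhs[OF has_derivative_inner[OF W W]])
      (simp add: fun_eq_iff inner_commute)
  have "((\<lambda>u. exp (sqrt \<mu> * u) *
      ((1 + \<Delta>1) * (f (X u) - f xstar) + 1 / 2 * inner (W u) (W u))) has_real_derivative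
    exp (sqrt \<mu> * t) *
      (sqrt \<mu> * ((1 + \<Delta>1) * (f (X t) - f xstar) + 1 / 2 * inner (W t) (W t))
        + (1 + \<Delta>1) * inner (gradient f (X t)) (velocity X t) + inner (W t) W'))
    (at t within {0..})"
    by (auto intro!: derivative_eq_intros fX WW simp: algebra_simps)
  moreover have "energy \<mu> \<Delta>1 \<Delta>2 f xstar X = (\<lambda>u. exp (sqrt \<mu> * u) *
      ((1 + \<Delta>1) * (f (X u) - f xstar) + 1 / 2 * inner (W u) (W u)))"
    by (simp add: energy_def W_def fun_eq_iff power2_norm_eq_inner)
  ultimately show ?thesis
    by (simp add: V_def W_def W'_def power2_norm_eq_inner)
qed

text \<open>The purely algebraic core, with \<open>\<delta>\<close> in place of the gap, \<open>s\<close> of \<open>sqrt \<mu>\<close>, \<open>a\<close> of \<open>\<Delta>1\<close> and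
  \<open>d\<close> of \<open>\<Delta>2\<close>.  Expanding the left-hand side, the terms
  \<open>\<langle>v, z\<rangle>\<close> and \<open>\<langle>v, g\<rangle>\<close> cancel.  The first hypothesis is used with weight \<open>s * (1 + a)\<close>, the second
  with weight \<open>d\<close>.\<close>

lemma energy_dissipation:
  fixes v z g :: "'a::real_inner" and s a d \<delta> :: real
  assumes gap: "\<delta> \<le> inner z g - s\<^sup>2 / 2 * (norm z)\<^sup>2"
    and mixed: "s\<^sup>2 * inner z g \<le> (norm g)\<^sup>2"
    and "s \<ge> 0" "a \<ge> 0" "d \<ge> 0"
  defines "V \<equiv> v + s *\<^sub>R z + d *\<^sub>R g"
  shows "s * ((1 + a) * \<delta> + 1 / 2 * (norm V)\<^sup>2) + (1 + a) * inner g v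
      + inner V (- (s *\<^sub>R v) - (1 + a) *\<^sub>R g)
    \<le> - (s / 2) * (norm v)\<^sup>2 - s\<^sup>2 * s / 2 * a * (norm z)\<^sup>2 + d * (s / 2 * d - a) * (norm g)\<^sup>2"
proof -
  have "s * ((1 + a) * \<delta> + 1 / 2 * (norm V)\<^sup>2) + (1 + a) * inner g v
      + inner V (- (s *\<^sub>R v) - (1 + a) *\<^sub>R g)
    = - (s / 2) * inner v v - s\<^sup>2 * s / 2 * a * inner z z + d * (s / 2 * d - a) * inner g g
      + s * (1 + a) * (\<delta> - (inner z g - s\<^sup>2 / 2 * inner z z)) + d * (s\<^sup>2 * inner z g - inner g g)"
    unfolding V_def power2_norm_eq_inner
    by (simp add: inner_simps inner_commute[of z v] inner_commute[of g v] inner_commute[of g z])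
      (simp add: field_simps power2_eq_square)
  moreover have "s * (1 + a) * (\<delta> - (inner z g - s\<^sup>2 / 2 * inner z z)) \<le> 0"
    using assms by (intro mult_nonneg_nonpos) (auto simp: power2_norm_eq_inner)
  moreover have "d * (s\<^sup>2 * inner z g - inner g g) \<le> 0"
    using assms by (intro mult_nonneg_nonpos) (auto simp: power2_norm_eq_inner)
  ultimately show ?thesis
    by (simp add: power2_norm_eq_inner)
qed

lemma gap_le_energy:
  assumes "\<Delta>1 \<ge> 0" and "energy \<mu> \<Delta>1 \<Delta>2 f xstar X t \<le> c"
  shows "f (X t) - f xstar \<le> 1 / (1 + \<Delta>1) * exp (- (sqrt \<mu> * t)) * c"
proof -
  have "exp (sqrt \<mu> * t) * ((1 + \<Delta>1) * (f (X t) - f xstar)) \<le> energy \<mu> \<Delta>1 \<Delta>2 f xstar X t"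
    unfolding energy_def by (intro mult_left_mono) auto
  then have "1 / (1 + \<Delta>1) * exp (- (sqrt \<mu> * t))
      * (exp (sqrt \<mu> * t) * ((1 + \<Delta>1) * (f (X t) - f xstar)))
    \<le> 1 / (1 + \<Delta>1) * exp (- (sqrt \<mu> * t)) * c"
    using assms by (intro mult_left_mono) auto
  moreover have "exp (- (sqrt \<mu> * t)) * exp (sqrt \<mu> * t) = 1"
    by (simp add: exp_add[symmetric])
  ultimately show ?thesis
    using assms(1) by (simp add: mult.assoc[symmetric])
qed

theorem theorem1:
  fixes f :: "'a::real_inner \<Rightarrow> real"
    and \<mu> \<Delta>1 \<Delta>2 :: real
    and xstar :: 'a
    and X :: "real \<Rightarrow> 'a"
  assumes finite_dim: "\<exists>B. finite B \<and> span B = (UNIV :: 'a set)"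
    and C2: "twice_continuously_differentiable f"
    and mu_pos: "\<mu> > 0"
    and convex: "strongly_convex \<mu> f"
    and minimizer: "is_arg_min f (\<lambda>_. True) xstar"
    and Delta1: "\<Delta>1 \<ge> 0"
    and Delta2: "\<Delta>2 \<ge> 0"
    and solution: "ode_solution \<mu> \<Delta>1 \<Delta>2 f X"
  shows
    "(\<forall>t\<ge>0. \<exists>D. (energy \<mu> \<Delta>1 \<Delta>2 f xstar X has_real_derivative D) (at t within {0..}) \<and>
        D * exp (- (sqrt \<mu> * t)) \<le>
          - (sqrt \<mu> / 2) * (norm (velocity X t))\<^sup>2
          - \<mu> * sqrt \<mu> / 2 * \<Delta>1 * (norm (X t - xstar))\<^sup>2
          + \<Delta>2 * (sqrt \<mu> / 2 * \<Delta>2 - \<Delta>1) * (norm (gradient f (X t)))\<^sup>2) \<and>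
     (0 \<le> sqrt \<mu> / 2 * \<Delta>2 \<and> sqrt \<mu> / 2 * \<Delta>2 \<le> \<Delta>1 \<longrightarrow>
        (\<forall>t\<ge>0. f (X t) - f xstar \<le>
          1 / (1 + \<Delta>1) * exp (- (sqrt \<mu> * t)) * energy \<mu> \<Delta>1 \<Delta>2 f xstar X 0)) \<and>
     (\<forall>L. \<Delta>1 = 0 \<and> \<Delta>2 > 0 \<and> smooth_gradient L f \<longrightarrow>
        (\<forall>t\<ge>0. f (X t) - f xstar \<le>
          1 / (1 + \<Delta>1) * exp (- (sqrt \<mu> * t * (1 - \<Delta>2\<^sup>2 * L)))
            * energy \<mu> \<Delta>1 \<Delta>2 f xstar X 0))"
proof -
  let ?E = "energy \<mu> \<Delta>1 \<Delta>2 f xstar X"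
  let ?R = "\<lambda>t. - (sqrt \<mu> / 2) * (norm (velocity X t))\<^sup>2
          - \<mu> * sqrt \<mu> / 2 * \<Delta>1 * (norm (X t - xstar))\<^sup>2
          + \<Delta>2 * (sqrt \<mu> / 2 * \<Delta>2 - \<Delta>1) * (norm (gradient f (X t)))\<^sup>2"
  have diff: "\<And>x. GDERIV f x :> gradient f x"
    using C2 by (rule gderiv_gradient)
  have min: "\<And>x. f xstar \<le> f x"
    using minimizer by (simp add: is_arg_min_linorder)
  have cancel: "exp x * k * exp (- x) = k" for x k :: real
    by (simp add: exp_minus)
  have sq: "(sqrt \<mu>)\<^sup>2 = \<mu>"
    using mu_pos by simp
  have "\<exists>D. (?E has_real_derivative D) (at t within {0..}) \<and> D * exp (- (sqrt \<mu> * t)) \<le> ?R t"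
    if "t \<ge> 0" for t
  proof (intro exI conjI)
    show "(?E has_real_derivative
      exp (sqrt \<mu> * t) *
        (sqrt \<mu> * ((1 + \<Delta>1) * (f (X t) - f xstar) + 1 / 2 * (norm (velocity X t
            + sqrt \<mu> *\<^sub>R (X t - xstar) + \<Delta>2 *\<^sub>R gradient f (X t)))\<^sup>2)
          + (1 + \<Delta>1) * inner (gradient f (X t)) (velocity X t)
          + inner (velocity X t + sqrt \<mu> *\<^sub>R (X t - xstar) + \<Delta>2 *\<^sub>R gradient f (X t))
              (- (sqrt \<mu> *\<^sub>R velocity X t) - (1 + \<Delta>1) *\<^sub>R gradient f (X t))))
      (at t within {0..})" (is "(_ has_real_derivative _ * ?K) _")
      using C2 solution that by (rule energy_has_real_derivative)
    have "?K \<le> ?R t"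
      using energy_dissipation[of "f (X t) - f xstar" "X t - xstar" "gradient f (X t)" "sqrt \<mu>"
          \<Delta>1 \<Delta>2 "velocity X t"]
        gap_le_inner_gradient[OF diff mu_pos convex min, of "X t"]
        inner_gradient_le[OF diff mu_pos convex min, of "X t"]
        mu_pos Delta1 Delta2
      unfolding sq by simp
    then show "exp (sqrt \<mu> * t) * ?K * exp (- (sqrt \<mu> * t)) \<le> ?R t"
      unfolding cancel .
  qed
  then obtain E' where E': "\<And>t. t \<ge> 0 \<Longrightarrow> (?E has_real_derivative E' t) (at t within {0..})"
    and bound: "\<And>t. t \<ge> 0 \<Longrightarrow> E' t * exp (- (sqrt \<mu> * t)) \<le> ?R t"
    by metis
  have bound': "E' t \<le> exp (sqrt \<mu> * t) * ?R t" if "t \<ge> 0" for t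
  proof -
    have "exp (sqrt \<mu> * t) * (E' t * exp (- (sqrt \<mu> * t))) \<le> exp (sqrt \<mu> * t) * ?R t"
      using bound[OF that] by (intro mult_left_mono) auto
    then show ?thesis
      unfolding mult.assoc[symmetric] cancel .
  qed
  have rate: "f (X t) - f xstar \<le> 1 / (1 + \<Delta>1) * exp (- (sqrt \<mu> * t)) * (exp (c * t) * ?E 0)"
    if "\<And>t. t \<ge> 0 \<Longrightarrow> exp (sqrt \<mu> * t) * ?R t \<le> c * ?E t" and "t \<ge> 0" for c t
  proof -
    have "E' u \<le> c * ?E u" if "u \<ge> 0" for u
      using bound'[OF that] \<open>\<And>t. t \<ge> 0 \<Longrightarrow> exp (sqrt \<mu> * t) * ?R t \<le> c * ?E t\<close>[OF that]
      by (rule order_trans)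
    with E' have "?E t \<le> exp (c * t) * ?E 0"
      using \<open>t \<ge> 0\<close> by (rule gronwall_half_line)
    with Delta1 show ?thesis
      by (rule gap_le_energy)
  qed
  have "f (X t) - f xstar \<le> 1 / (1 + \<Delta>1) * exp (- (sqrt \<mu> * t)) * ?E 0"
    if "sqrt \<mu> / 2 * \<Delta>2 \<le> \<Delta>1" "t \<ge> 0" for t
  proof -
    have "?R u \<le> 0" for u
    proof -
      have "\<mu> * sqrt \<mu> / 2 * \<Delta>1 * (norm (X u - xstar))\<^sup>2 \<ge> 0"
        "sqrt \<mu> / 2 * (norm (velocity X u))\<^sup>2 \<ge> 0"
        using mu_pos Delta1 by auto
      moreover have "\<Delta>2 * (sqrt \<mu> / 2 * \<Delta>2 - \<Delta>1) * (norm (gradient f (X u)))\<^sup>2 \<le> 0"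
        using Delta2 that(1) by (intro mult_nonpos_nonneg mult_nonneg_nonpos) auto
      ultimately show ?thesis by linarith
    qed
    then have "exp (sqrt \<mu> * u) * ?R u \<le> 0 * ?E u" for u
      unfolding mult_zero_left by (intro mult_nonneg_nonpos) auto
    then show ?thesis
      using rate[of 0 t] \<open>t \<ge> 0\<close> by simp
  qed
  moreover have "f (X t) - f xstar
      \<le> 1 / (1 + \<Delta>1) * exp (- (sqrt \<mu> * t * (1 - \<Delta>2\<^sup>2 * L))) * ?E 0"
    if "\<Delta>1 = 0" "smooth_gradient L f" "t \<ge> 0" for L t
  proof -
    have "exp (sqrt \<mu> * u) * ?R u \<le> (sqrt \<mu> * \<Delta>2\<^sup>2 * L) * ?E u" for u
    proof -
      define V where "V = velocity X u + sqrt \<mu> *\<^sub>R (X u - xstar) + \<Delta>2 *\<^sub>R gradient f (X u)"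
      define P where "P = 1 / 2 * (norm V)\<^sup>2"
      have "L * P \<ge> 0"
      proof (cases "L \<ge> 0")
        case True
        then show ?thesis by (simp add: P_def)
      next
        \<comment> \<open>A negative Lipschitz constant is possible only in the trivial space.\<close>
        case False
        have "x = 0" for x :: 'a
        proof -
          have "0 \<le> norm (gradient f x - gradient f 0)" by simp
          also have "\<dots> \<le> L * norm (x - 0)"
            using that(2) unfolding smooth_gradient_def by blast
          finally show ?thesis
            using False by (simp add: zero_le_mult_iff)
        qed
        then have "V = 0" .
        then show ?thesis by (simp add: P_def)
      qed
      then have P: "sqrt \<mu> * \<Delta>2\<^sup>2 * (L * P) \<ge> 0"
        using mu_pos by simp
      have "?R u \<le> sqrt \<mu> / 2 * \<Delta>2\<^sup>2 * (norm (gradient f (X u)))\<^sup>2"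
        using mu_pos that(1) by (simp add: power2_eq_square)
      also have "\<dots> \<le> sqrt \<mu> / 2 * \<Delta>2\<^sup>2 * (2 * L * (f (X u) - f xstar))"
        using norm_gradient_power2_le_gap[OF diff mu_pos convex min that(2)] mu_pos
        by (intro mult_left_mono) auto
      also have "\<dots> \<le> sqrt \<mu> * \<Delta>2\<^sup>2 * L * (f (X u) - f xstar + P)"
        using P by (simp add: algebra_simps)
      finally have "exp (sqrt \<mu> * u) * ?R u
          \<le> exp (sqrt \<mu> * u) * (sqrt \<mu> * \<Delta>2\<^sup>2 * L * (f (X u) - f xstar + P))"
        by (intro mult_left_mono) auto
      also have "\<dots> = (sqrt \<mu> * \<Delta>2\<^sup>2 * L) * ?E u"
        using that(1) by (simp add: energy_def P_def V_def)
      finally show ?thesis .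
    qed
    then have "f (X t) - f xstar
        \<le> 1 / (1 + \<Delta>1) * exp (- (sqrt \<mu> * t)) * (exp (sqrt \<mu> * \<Delta>2\<^sup>2 * L * t) * ?E 0)"
      using rate \<open>t \<ge> 0\<close> by blast
    also have "\<dots> = 1 / (1 + \<Delta>1) * exp (- (sqrt \<mu> * t) + sqrt \<mu> * \<Delta>2\<^sup>2 * L * t) * ?E 0"
      unfolding exp_add by (simp add: mult.assoc)
    also have "- (sqrt \<mu> * t) + sqrt \<mu> * \<Delta>2\<^sup>2 * L * t = - (sqrt \<mu> * t * (1 - \<Delta>2\<^sup>2 * L))"
      by (simp add: algebra_simps)
    finally show ?thesis .
  qed
  ultimately show ?thesis
    using E' bound by blast
qed

end
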